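(* Let $R$ be a commutative ring with identity that contains $\mathbb{Q}$, and let $N \ge 2$. (a) A polynomial $p \in R[X_1,\ldots,X_N]$ satisfies $M_{jk}p = 0$ for all distinct $j,k \in \{1,\ldots,N\}$ if and only if $p$ is a polynomial in $X_1^2+\cdots+X_N^2$ with coefficients in $R$. (b) An $R$-linear derivation $L$ of $R[X_1,\ldots,X_N]$ satisfies $L(X_1^2+\cdots+X_N^2)=0$ if and only if $L$ is an $R[X_1,\ldots,X_N]$-linear combination of the operators $M_{jk}$ ($j \neq k$).
   Context: For distinct $j,k \in \{1,\ldots,N\}$, $M_{jk} = X_j\partial_k - X_k\partial_j$ is an operator on $R[X_1,\ldots,X_N]$, where $\partial_j = \partial/\partial X_j$. *)

theory Defs
  imports Complex_Main "HOL-Library.Poly_Mapping" "HOL-Library.Cardinality" "HOL-Computational_Algebra.Polynomial"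
begin

text \<open>The variables of the polynomial ring are indexed by the elements of a finite type
  \<open>'n\<close>, so \<open>N = CARD('n)\<close>. A polynomial maps each exponent vector to its coefficient.\<close>

type_synonym ('n, 'a) mpoly = "('n \<Rightarrow>\<^sub>0 nat) \<Rightarrow>\<^sub>0 'a"

definition Const :: "'a \<Rightarrow> ('n, 'a::comm_ring_1) mpoly" where
  "Const c = Poly_Mapping.single 0 c"

definition X :: "'n \<Rightarrow> ('n, 'a::comm_ring_1) mpoly" where
  "X j = Poly_Mapping.single (Poly_Mapping.single j 1) 1"

text \<open>When \<open>m\<close> does not contain the variable \<open>j\<close>, the subtraction below truncates, but then the
  coefficient is zero.\<close>

definition partial_deriv :: "'n \<Rightarrow> ('n, 'a::comm_ring_1) mpoly \<Rightarrow> ('n, 'a) mpoly" where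
  "partial_deriv j p = (\<Sum>m\<in>Poly_Mapping.keys p.
     Poly_Mapping.single (m - Poly_Mapping.single j 1)
       (of_nat (Poly_Mapping.lookup m j) * Poly_Mapping.lookup p m))"

definition M :: "'n \<Rightarrow> 'n \<Rightarrow> ('n, 'a::comm_ring_1) mpoly \<Rightarrow> ('n, 'a) mpoly" where
  "M j k p = X j * partial_deriv k p - X k * partial_deriv j p"

definition sum_squares :: "('n::finite, 'a::comm_ring_1) mpoly" where
  "sum_squares = (\<Sum>j\<in>UNIV. X j ^ 2)"

definition is_poly_in :: "('n, 'a::comm_ring_1) mpoly \<Rightarrow> ('n, 'a) mpoly \<Rightarrow> bool" where
  "is_poly_in s p \<longleftrightarrow> (\<exists>q :: 'a poly. p = poly (map_poly Const q) s)"

definition scale :: "'a \<Rightarrow> ('n, 'a::comm_ring_1) mpoly \<Rightarrow> ('n, 'a) mpoly" where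
  "scale c p = Const c * p"

definition derivation :: "(('n, 'a::comm_ring_1) mpoly \<Rightarrow> ('n, 'a) mpoly) \<Rightarrow> bool" where
  "derivation L \<longleftrightarrow> module_hom scale scale L \<and> (\<forall>p q. L (p * q) = p * L q + L p * q)"

definition contains_rationals :: "'a::comm_ring_1 itself \<Rightarrow> bool" where
  "contains_rationals _ \<longleftrightarrow> (\<exists>\<phi> :: rat \<Rightarrow> 'a. inj \<phi> \<and> \<phi> 1 = 1 \<and>
     (\<forall>x y. \<phi> (x + y) = \<phi> x + \<phi> y) \<and> (\<forall>x y. \<phi> (x * y) = \<phi> x * \<phi> y))"

lemma module_scale: "module (scale :: 'a \<Rightarrow> ('n, 'a::comm_ring_1) mpoly \<Rightarrow> _)"
  by standard
    (simp_all add: scale_def Const_def algebra_simps single_add mult_single flip: mult.assoc)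

lemma partial_deriv_single:
  "partial_deriv j (Poly_Mapping.single m c) =
     Poly_Mapping.single (m - Poly_Mapping.single j 1) (of_nat (Poly_Mapping.lookup m j) * c)"
  by (simp add: partial_deriv_def)

lemma partial_deriv_add: "partial_deriv j (p + q) = partial_deriv j p + partial_deriv j q"
proof -
  define g :: "_ \<Rightarrow> 'b \<Rightarrow> _" where
    "g m c = Poly_Mapping.single (m - Poly_Mapping.single j 1) (of_nat (Poly_Mapping.lookup m j) * c)"
    for m c
  have eq: "partial_deriv j r = (\<Sum>m\<in>S. g m (Poly_Mapping.lookup r m))"
    if "finite S" "Poly_Mapping.keys r \<subseteq> S" for S r
    unfolding partial_deriv_def g_def
    by (rule sum.mono_neutral_left) (use that in \<open>auto simp: in_keys_iff\<close>)
  let ?S = "Poly_Mapping.keys p \<union> Poly_Mapping.keys q"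
  have "Poly_Mapping.keys (p + q) \<subseteq> ?S" by (rule Poly_Mapping.keys_add)
  then show ?thesis
    by (simp add: eq[of ?S] lookup_add g_def distrib_left single_add sum.distrib)
qed

end

theory Submission
  imports Defs
begin

text \<open>
  (a) If \<open>X\<^sub>j \<partial>\<^sub>k p = X\<^sub>k \<partial>\<^sub>j p\<close> for all \<open>j \<noteq> k\<close>, then each \<open>X\<^sub>k\<close> divides \<open>\<partial>\<^sub>k p\<close> and the
  quotient is one polynomial \<open>g\<close>, the same for all \<open>k\<close>. Since mixed partial derivatives commute, \<open>g\<close>
  satisfies the same equations. As \<open>g\<close> has lower degree, it is a polynomial \<open>G(s)\<close> in the sum of
  squares \<open>s\<close>, and \<open>p\<close> differs by a constant from \<open>Q(s)\<close>, where \<open>2 Q' = G\<close>.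

  (b) A derivation is \<open>L = \<Sum>\<^sub>k a\<^sub>k \<partial>\<^sub>k\<close> with \<open>a\<^sub>k = L X\<^sub>k\<close>, and \<open>L s = 2 \<Sum>\<^sub>k X\<^sub>k a\<^sub>k\<close>. If this vanishes,
  Euler's formula gives \<open>\<Sum>\<^sub>j X\<^sub>j (\<partial>\<^sub>j a\<^sub>k - \<partial>\<^sub>k a\<^sub>j) = (d + 1) a\<^sub>k\<close> for \<open>a\<^sub>k\<close> homogeneous of degree \<open>d\<close>.
  After division by \<open>d + 1\<close> on each homogeneous part, \<open>a\<^sub>k = \<Sum>\<^sub>j X\<^sub>j c\<^sub>j\<^sub>k\<close> with \<open>c\<close> antisymmetric, so
  that \<open>L\<close> is the sum of the operators \<open>c\<^sub>j\<^sub>k M\<^sub>j\<^sub>k / 2\<close>.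
\<close>

section \<open>Coefficients\<close>

text \<open>Serves twice: for polynomials it reduces additive claims to single terms, and for
  exponent vectors, which are finitely supported maps too, to powers of one variable.\<close>

lemma poly_mapping_add_induct [case_names zero single add]:
  fixes p :: "'b \<Rightarrow>\<^sub>0 'c::comm_monoid_add"
  assumes "P 0" "\<And>k v. P (Poly_Mapping.single k v)" "\<And>f g. P f \<Longrightarrow> P g \<Longrightarrow> P (f + g)"
  shows "P p"
proof (induction p rule: update_induct)
  case const
  then show ?case by (fact assms(1))
next
  case (update f a b)
  have "Poly_Mapping.update a b f = f + Poly_Mapping.single a b"
    using update.hyps(1)
    by (intro poly_mapping_eqI)
      (auto simp: lookup_update lookup_add lookup_single in_keys_iff when_def)
  with update.IH show ?case by (simp add: assms)
qed

lemma diff_single_add_single: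
  fixes m :: "'n \<Rightarrow>\<^sub>0 nat"
  assumes "Poly_Mapping.lookup m j \<noteq> 0"
  shows "m - Poly_Mapping.single j 1 + Poly_Mapping.single j 1 = m"
  using assms by (intro poly_mapping_eqI) (auto simp: lookup_add lookup_minus lookup_single when_def)

lemma lookup_X_mult:
  "Poly_Mapping.lookup (X j * p) m =
     (if Poly_Mapping.lookup m j = 0 then 0 else Poly_Mapping.lookup p (m - Poly_Mapping.single j 1))"
proof (induction p rule: poly_mapping_add_induct)
  case zero
  then show ?case by simp
next
  case (single n c)
  have "Poly_Mapping.single j 1 + n = m \<longleftrightarrow>
      Poly_Mapping.lookup m j \<noteq> 0 \<and> n = m - Poly_Mapping.single j 1"
    by (metis diff_single_add_single add.commute add_diff_cancel_right' lookup_add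
        lookup_single_eq add_is_0 one_neq_zero)
  then show ?case by (auto simp: X_def mult_single lookup_single when_def)
next
  case (add f g)
  then show ?case by (simp add: distrib_left lookup_add)
qed

lemma lookup_X_mult_add_single [simp]:
  "Poly_Mapping.lookup (X j * p) (m + Poly_Mapping.single j (Suc 0)) = Poly_Mapping.lookup p m"
  by (simp add: lookup_X_mult lookup_add)

text \<open>Indexing by the exponent of the result replaces the truncated subtraction by an
  addition, which later coefficient comparisons can handle.\<close>

lemma lookup_partial_deriv:
  "Poly_Mapping.lookup (partial_deriv j p) m =
     of_nat (Suc (Poly_Mapping.lookup m j)) * Poly_Mapping.lookup p (m + Poly_Mapping.single j 1)"
proof (induction p rule: poly_mapping_add_induct)
  case zero
  then show ?case by (simp add: partial_deriv_def)
next
  case (single n c)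
  have "n = m + Poly_Mapping.single j 1 \<longleftrightarrow>
      Poly_Mapping.lookup n j \<noteq> 0 \<and> n - Poly_Mapping.single j 1 = m"
    by (metis diff_single_add_single add_diff_cancel_right' lookup_add
        lookup_single_eq add_is_0 one_neq_zero)
  moreover have "Poly_Mapping.lookup n j = Suc (Poly_Mapping.lookup m j)"
    if "n = m + Poly_Mapping.single j 1"
    using that by (simp add: lookup_add)
  ultimately show ?case by (auto simp: partial_deriv_single lookup_single when_def)
next
  case (add f g)
  then show ?case by (simp add: partial_deriv_add lookup_add distrib_left)
qed

lemma partial_deriv_zero [simp]: "partial_deriv j 0 = 0"
  by (simp add: partial_deriv_def)

lemma partial_deriv_sum: "partial_deriv j (sum f A) = (\<Sum>i\<in>A. partial_deriv j (f i))"
  by (induction A rule: infinite_finite_induct) (auto simp: partial_deriv_add)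

lemma partial_deriv_diff: "partial_deriv j (p - q) = partial_deriv j p - partial_deriv j q"
  by (metis add_diff_cancel_right' diff_add_cancel partial_deriv_add)

lemma partial_deriv_commute: "partial_deriv j (partial_deriv k p) = partial_deriv k (partial_deriv j p)"
  by (intro poly_mapping_eqI)
    (auto simp: lookup_partial_deriv lookup_add lookup_single when_def ac_simps)

lemma partial_deriv_Const [simp]: "partial_deriv j (Const c) = 0"
  by (simp add: Const_def partial_deriv_single)

lemma partial_deriv_X: "partial_deriv j (X k) = (if j = k then 1 else 0)"
  by (auto simp: X_def partial_deriv_single lookup_single)

text \<open>Both sides are additive in \<open>p\<close> and in \<open>q\<close>, so two monomials
  suffice, and there the factor k + l splits into the two Leibniz terms.\<close>

lemma partial_deriv_mult: "partial_deriv j (p * q) = p * partial_deriv j q + partial_deriv j p * q"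
proof (induction p rule: poly_mapping_add_induct)
  case (single m c)
  show ?case
  proof (induction q rule: poly_mapping_add_induct)
    case (single n d)
    have *: "m + n - Poly_Mapping.single j (Suc 0) = m + (n - Poly_Mapping.single j (Suc 0))"
      if "Poly_Mapping.lookup n j \<noteq> 0" for m n :: "'a \<Rightarrow>\<^sub>0 nat"
    proof -
      have "m + n = m + (n - Poly_Mapping.single j (Suc 0)) + Poly_Mapping.single j (Suc 0)"
        using diff_single_add_single[OF that] by (simp add: add.assoc)
      then show ?thesis by (metis add_diff_cancel_right')
    qed
    have **: "m + n - Poly_Mapping.single j (Suc 0) = m - Poly_Mapping.single j (Suc 0) + n"
      if "Poly_Mapping.lookup m j \<noteq> 0"
      using *[OF that, of n] by (simp only: add.commute)
    have coeff: "of_nat (k + l) * (c * d) = c * (of_nat l * d) + of_nat k * c * d" for k l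
      by (simp add: algebra_simps)
    show ?case
    proof (cases "Poly_Mapping.lookup n j = 0")
      case True
      then show ?thesis
        by (cases "Poly_Mapping.lookup m j = 0")
          (simp_all add: partial_deriv_single mult_single lookup_add ** mult.assoc)
    next
      case False
      \<comment> \<open>If X_j does not occur in \<open>m\<close>, truncation may make the two
        exponents differ, but then the coefficient is zero.\<close>
      have "of_nat k * c * d = 0 \<or>
          m - Poly_Mapping.single j (Suc 0) + n = m + (n - Poly_Mapping.single j (Suc 0))"
        if "k = Poly_Mapping.lookup m j" for k
        using that *[OF False, of m] ** by (cases "k = 0") simp_all
      then have "Poly_Mapping.single (m - Poly_Mapping.single j (Suc 0) + n)
            (of_nat (Poly_Mapping.lookup m j) * c * d) =
          Poly_Mapping.single (m + (n - Poly_Mapping.single j (Suc 0)))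
            (of_nat (Poly_Mapping.lookup m j) * c * d)"
        by (metis single_zero)
      then show ?thesis
        unfolding mult_single partial_deriv_single lookup_add coeff One_nat_def *[OF False]
        by (simp only: single_add)
    qed
  qed (auto simp: partial_deriv_add algebra_simps)
qed (auto simp: partial_deriv_add algebra_simps)

section \<open>Derivations\<close>

text \<open>By the Leibniz rule L(c p) = c L(p) + L(c) p, so commuting with constants amounts to
  killing them (take p = 1).\<close>

lemma derivation_iff:
  "derivation L \<longleftrightarrow> (\<forall>p q. L (p + q) = L p + L q) \<and> (\<forall>c. L (Const c) = 0) \<and>
     (\<forall>p q. L (p * q) = p * L q + L p * q)"
proof -
  have "(\<forall>c p. L (Const c * p) = Const c * L p) \<longleftrightarrow> (\<forall>c. L (Const c) = 0)"
    if "\<forall>p q. L (p * q) = p * L q + L p * q"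
    unfolding that[rule_format] by (metis add_cancel_left_right mult_1_right mult_zero_left)
  then show ?thesis
    by (auto simp: derivation_def module_hom_iff module_scale scale_def)
qed

lemma derivation_partial_deriv: "derivation (partial_deriv j)"
  by (simp add: derivation_iff partial_deriv_add partial_deriv_mult)

lemma derivation_cmult: "derivation L \<Longrightarrow> derivation (\<lambda>p. a * L p)"
  by (simp add: derivation_iff algebra_simps)

lemma derivation_sum:
  "(\<And>i. i \<in> A \<Longrightarrow> derivation (L i)) \<Longrightarrow> derivation (\<lambda>p. \<Sum>i\<in>A. L i p)"
  by (simp add: derivation_iff sum.distrib sum_distrib_left sum_distrib_right)

lemma derivation_one:
  assumes "derivation L"
  shows "L 1 = 0"
proof -
  have "L (1 * 1) = 1 * L 1 + L 1 * 1" using assms unfolding derivation_iff by blast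
  then show ?thesis by simp
qed

text \<open>The polynomials on which \<open>L\<close> and \<open>L'\<close> agree contain the
  constants and the variables and are closed under sums and products.\<close>

lemma derivation_eqI:
  assumes "derivation L" "derivation L'" "\<And>k. L (X k) = L' (X k)"
  shows "L = L'"
proof
  fix p
  have split: "Poly_Mapping.single m c = Const c * Poly_Mapping.single m 1"
    for m :: "'a \<Rightarrow>\<^sub>0 nat" and c :: 'b
    by (simp add: Const_def mult_single)
  have one: "L 1 = L' 1" using assms by (simp add: derivation_one)
  have mult: "L (p * q) = L' (p * q)" if "L p = L' p" "L q = L' q" for p q
    using assms(1,2) that by (simp add: derivation_iff)
  have monom: "L (Poly_Mapping.single m 1) = L' (Poly_Mapping.single m 1)" for m
  proof (induction m rule: poly_mapping_add_induct)
    case zero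
    then show ?case using one by simp
  next
    case (single k n)
    show ?case
    proof (induction n)
      case 0
      then show ?case using one by simp
    next
      case (Suc n)
      have "Poly_Mapping.single (Poly_Mapping.single k (Suc n)) (1::'b) =
          X k * Poly_Mapping.single (Poly_Mapping.single k n) 1"
        by (simp add: X_def mult_single flip: single_add)
      then show ?case using mult[OF assms(3) Suc] by simp
    qed
  next
    case (add m n)
    then show ?case using mult[OF add] by (simp add: mult_single)
  qed
  show "L p = L' p"
  proof (induction p rule: poly_mapping_add_induct)
    case zero
    have "L (0 + 0) = L 0 + L 0" "L' (0 + 0) = L' 0 + L' 0"
      using assms(1,2) unfolding derivation_iff by blast+
    then show ?case by simp
  next
    case (single m c)
    show ?case
      using assms(1,2) monom unfolding split[of m c] by (simp add: derivation_iff)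
  next
    case (add p q)
    then show ?case using assms(1,2) by (simp add: derivation_iff)
  qed
qed

lemma derivation_eq_sum_partial_deriv:
  fixes L :: "('n::finite, 'a::comm_ring_1) mpoly \<Rightarrow> ('n, 'a) mpoly"
  assumes "derivation L"
  shows "L = (\<lambda>p. \<Sum>k\<in>UNIV. L (X k) * partial_deriv k p)"
  by (rule derivation_eqI)
    (auto intro!: assms derivation_sum derivation_cmult derivation_partial_deriv
      simp: partial_deriv_X if_distrib cong: if_cong)

lemma partial_deriv_sum_squares: "partial_deriv k (sum_squares :: ('n::finite, 'a::comm_ring_1) mpoly) = 2 * X k"
proof -
  have "partial_deriv k (X j ^ 2 :: ('n, 'a) mpoly) = (if k = j then 2 * X j else 0)" for j
    by (simp add: power2_eq_square partial_deriv_mult partial_deriv_X)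
  then show ?thesis by (simp add: sum_squares_def partial_deriv_sum)
qed

section \<open>Polynomials annihilated by the operators M\<close>

lemma is_poly_inI:
  fixes s p :: "('n, 'a::comm_ring_1) mpoly"
  assumes "p = (\<Sum>i<n. Const (c i) * s ^ i)"
  shows "is_poly_in s p"
proof -
  define q where "q = Poly (map c [0..<n])"
  define Q :: "('n, 'a) mpoly poly" where "Q = map_poly Const q"
  have coeff: "coeff q i = (if i < n then c i else 0)" for i
    by (simp add: q_def nth_default_def)
  have Const_0: "Const (0 :: 'a) = (0 :: ('n, 'a) mpoly)"
    by (simp add: Const_def)
  have "poly Q s = (\<Sum>i\<le>degree Q. Const (coeff q i) * s ^ i)"
    by (simp add: Q_def poly_altdef coeff_map_poly Const_0)
  \<comment> \<open>The larger index set allows for vanishing top coefficients and for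
    \<open>n = 0\<close>, where the index 0 lies only in \<open>{..degree Q}\<close>.\<close>
  also have "\<dots> = (\<Sum>i\<in>{..degree Q} \<union> {..<n}. Const (coeff q i) * s ^ i)"
  proof (rule sum.mono_neutral_left)
    show "\<forall>i\<in>{..degree Q} \<union> {..<n} - {..degree Q}.
        Const (coeff q i) * s ^ i = 0"
      using coeff_eq_0[of Q] by (auto simp: Q_def coeff_map_poly Const_0)
  qed auto
  also have "\<dots> = (\<Sum>i<n. Const (c i) * s ^ i)"
    by (rule sum.mono_neutral_cong_right) (auto simp: coeff Const_0)
  finally show ?thesis
    using assms unfolding is_poly_in_def Q_def by metis
qed

text \<open>Turns evaluation of a coefficient polynomial into a finite sum that can be
  differentiated term by term.\<close>

lemma is_poly_in_iff:
  fixes s p :: "('n, 'a::comm_ring_1) mpoly"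
  shows "is_poly_in s p \<longleftrightarrow> (\<exists>n c. p = (\<Sum>i<n. Const (c i) * s ^ i))"
proof
  assume "is_poly_in s p"
  then obtain q where q: "p = poly (map_poly Const q) s" by (auto simp: is_poly_in_def)
  have "p = (\<Sum>i<Suc (degree (map_poly Const q :: ('n, 'a) mpoly poly)). Const (coeff q i) * s ^ i)"
    unfolding q by (simp add: poly_altdef coeff_map_poly Const_def lessThan_Suc_atMost)
  then show "\<exists>n c. p = (\<Sum>i<n. Const (c i) * s ^ i)" by blast
qed (auto intro: is_poly_inI)

lemma partial_deriv_power:
  "partial_deriv k (p ^ Suc n) = of_nat (Suc n) * p ^ n * partial_deriv k p"
  by (induction n) (simp_all add: partial_deriv_mult algebra_simps)

text \<open>The rationals enter the arguments below through these inverses; \<open>r n\<close>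
  stands for 1/(n+1), which avoids a side condition on n.\<close>

lemma contains_rationals_inverse_Suc:
  assumes "contains_rationals TYPE('a::comm_ring_1)"
  obtains r :: "nat \<Rightarrow> 'a::comm_ring_1" where "\<And>n. of_nat (Suc n) * r n = 1"
proof -
  obtain \<phi> :: "rat \<Rightarrow> 'a" where one: "\<phi> 1 = 1"
    and add: "\<And>x y. \<phi> (x + y) = \<phi> x + \<phi> y" and mult: "\<And>x y. \<phi> (x * y) = \<phi> x * \<phi> y"
    using assms unfolding contains_rationals_def by blast
  have zero: "\<phi> 0 = 0" using add[of 0 0] by simp
  have "\<phi> (of_nat n) = of_nat n" for n
    by (induction n) (simp_all add: zero one add)
  then have "of_nat (Suc n) * \<phi> (1 / of_nat (Suc n)) = 1" for n
    by (metis mult one nonzero_mult_div_cancel_left of_nat_neq_0 times_divide_eq_right mult.right_neutral)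
  then show thesis by (rule that)
qed

text \<open>By the chain rule the gradient of each power of the sum of squares is a multiple of the
  vector of the variables, and \<open>M j k\<close> vanishes on any such polynomial.\<close>

lemma M_poly_sum_squares:
  fixes p :: "('n::finite, 'a::comm_ring_1) mpoly"
  assumes "is_poly_in sum_squares p"
  shows "M j k p = 0"
proof -
  obtain n c where p: "p = (\<Sum>i<n. Const (c i) * sum_squares ^ i)"
    using assms by (auto simp: is_poly_in_iff)
  have "\<exists>a. \<forall>k. partial_deriv k (sum_squares ^ i :: ('n, 'a) mpoly) = X k * a" for i
  proof (cases i)
    case 0
    then show ?thesis
      using derivation_one[OF derivation_partial_deriv] by (auto intro!: exI[of _ 0])
  next
    case (Suc l)
    have "partial_deriv k (sum_squares ^ i :: ('n, 'a) mpoly) =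
        X k * (of_nat (Suc l) * sum_squares ^ l * 2)" for k
      unfolding Suc partial_deriv_power partial_deriv_sum_squares by (simp only: ac_simps)
    then show ?thesis by blast
  qed
  then obtain a :: "nat \<Rightarrow> ('n, 'a) mpoly"
    where a: "\<And>i k. partial_deriv k (sum_squares ^ i) = X k * a i" by metis
  show ?thesis
    by (simp add: M_def p partial_deriv_sum partial_deriv_mult a sum_distrib_left ac_simps)
qed

text \<open>Multiplication by a variable only shifts coefficients, so it is injective even if the
  ring has zero divisors.\<close>

lemma X_mult_cancel: "X j * p = X j * q \<Longrightarrow> p = q"
  by (metis lookup_X_mult_add_single poly_mapping_eqI)

text \<open>Coefficients replace an argument by prime elements: a monomial of \<open>b\<close>
  without X_j would survive in X_k b, still without X_j, but every monomial of X_j a contains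
  X_j.\<close>

lemma X_dvdI:
  assumes "X j * a = X k * b" "j \<noteq> k"
  obtains g where "b = X j * g"
proof -
  have nz: "Poly_Mapping.lookup m j \<noteq> 0" if "Poly_Mapping.lookup b m \<noteq> 0" for m
  proof
    assume "Poly_Mapping.lookup m j = 0"
    then have "Poly_Mapping.lookup (X j * a) (m + Poly_Mapping.single k (Suc 0)) = 0"
      using assms(2) by (simp add: lookup_X_mult lookup_add lookup_single)
    then show False using that by (simp add: assms(1))
  qed
  define g where "g = (\<Sum>m\<in>Poly_Mapping.keys b.
    Poly_Mapping.single (m - Poly_Mapping.single j 1) (Poly_Mapping.lookup b m))"
  have "X j * g = (\<Sum>m\<in>Poly_Mapping.keys b. Poly_Mapping.single m (Poly_Mapping.lookup b m))"
    unfolding g_def sum_distrib_left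
  proof (rule sum.cong)
    fix m assume "m \<in> Poly_Mapping.keys b"
    then show "X j * Poly_Mapping.single (m - Poly_Mapping.single j 1) (Poly_Mapping.lookup b m) =
        Poly_Mapping.single m (Poly_Mapping.lookup b m)"
      using diff_single_add_single[OF nz, of m]
      by (simp add: X_def mult_single in_keys_iff add.commute)
  qed simp
  also have "\<dots> = b"
    by (intro poly_mapping_eqI) (auto simp: lookup_sum lookup_single when_def in_keys_iff)
  finally show thesis using that by metis
qed

text \<open>A nonconstant monomial contains some X_k, and its coefficient reappears in the
  derivative by X_k times a positive integer, which is invertible.\<close>

lemma partial_deriv_all_zero:
  fixes p :: "('n, 'a::comm_ring_1) mpoly"
  assumes "contains_rationals TYPE('a)" "\<And>k. partial_deriv k p = 0"
  shows "p = Const (Poly_Mapping.lookup p 0)"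
proof (rule poly_mapping_eqI)
  fix m
  obtain r :: "nat \<Rightarrow> 'a" where r: "\<And>n. of_nat (Suc n) * r n = 1"
    using contains_rationals_inverse_Suc[OF assms(1)] by blast
  show "Poly_Mapping.lookup p m = Poly_Mapping.lookup (Const (Poly_Mapping.lookup p 0)) m"
  proof (cases "m = 0")
    case False
    then obtain k where k: "Poly_Mapping.lookup m k \<noteq> 0"
      by (metis poly_mapping_eqI lookup_zero)
    define n where "n = Poly_Mapping.lookup (m - Poly_Mapping.single k 1) k"
    have "0 = Poly_Mapping.lookup (partial_deriv k p) (m - Poly_Mapping.single k 1)"
      by (simp add: assms(2))
    also have "\<dots> = of_nat (Suc n) * Poly_Mapping.lookup p m"
      unfolding lookup_partial_deriv n_def using diff_single_add_single[OF k] by simp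
    finally have "r n * (of_nat (Suc n) * Poly_Mapping.lookup p m) = 0" by simp
    then have "Poly_Mapping.lookup p m = 0"
      by (metis r mult.assoc mult.commute mult_1)
    then show ?thesis using False by (simp add: Const_def lookup_single)
  qed (simp add: Const_def)
qed

definition monom_degree :: "('n::finite \<Rightarrow>\<^sub>0 nat) \<Rightarrow> nat" where
  "monom_degree m = (\<Sum>i\<in>UNIV. Poly_Mapping.lookup m i)"

lemma monom_degree_add_single [simp]: "monom_degree (m + Poly_Mapping.single j n) = monom_degree m + n"
  by (simp add: monom_degree_def lookup_add lookup_single sum.distrib when_def)

text \<open>A second variable makes X_i divide the derivative by X_i. The quotient \<open>g\<close>
  of this one index serves every k, since X_i can be cancelled.\<close>

lemma M_zero_partial_deriv:
  fixes p :: "('n::finite, 'a::comm_ring_1) mpoly"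
  assumes "CARD('n) \<ge> 2" "\<And>j k. j \<noteq> k \<Longrightarrow> M j k p = 0"
  obtains g where "\<And>k. partial_deriv k p = X k * g"
proof -
  have eq: "X j * partial_deriv k p = X k * partial_deriv j p" for j k
    using assms(2)[of j k] by (cases "j = k") (simp_all add: M_def)
  obtain i j :: 'n where "i \<noteq> j"
    using assms(1) by (metis (full_types) card_2_iff' UNIV_I card_le_Suc0_iff_eq finite
        not_less_eq_eq numeral_2_eq_2)
  then obtain g where g: "partial_deriv i p = X i * g"
    using X_dvdI[OF eq] by metis
  have "partial_deriv k p = X k * g" for k
  proof (rule X_mult_cancel)
    show "X i * partial_deriv k p = X i * (X k * g)"
      using eq[of i k] g by (simp add: ac_simps)
  qed
  then show thesis by (rule that)
qed

text \<open>The arbitrary \<open>c\<close> is the constant of integration: a polynomial with the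
  same gradient as \<open>q\<close> differs from it by a constant.\<close>

lemma is_poly_in_antiderivative:
  fixes g :: "('n::finite, 'a::comm_ring_1) mpoly"
  assumes "contains_rationals TYPE('a)" "is_poly_in sum_squares g"
  obtains q where "\<And>c. is_poly_in sum_squares (q + Const c)" "\<And>k. partial_deriv k q = X k * g"
proof -
  obtain r :: "nat \<Rightarrow> 'a" where r: "\<And>n. of_nat (Suc n) * r n = 1"
    using contains_rationals_inverse_Suc[OF assms(1)] by blast
  obtain n b where g: "g = (\<Sum>i<n. Const (b i) * sum_squares ^ i)"
    using assms(2) by (auto simp: is_poly_in_iff)
  \<comment> \<open>Differentiating s^(i+1) by X_k gives (2i+2) s^i X_k, and
    \<open>r (2 * i + 1)\<close> is the inverse of 2i+2.\<close>
  define q where "q = (\<Sum>i<n. Const (r (2 * i + 1) * b i) * sum_squares ^ Suc i :: ('n, 'a) mpoly)"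
  show thesis
  proof
    fix c
    have "q + Const c =
        (\<Sum>i<Suc n. Const (case i of 0 \<Rightarrow> c | Suc i \<Rightarrow> r (2 * i + 1) * b i) * sum_squares ^ i)"
      unfolding sum.lessThan_Suc_shift q_def by simp
    then show "is_poly_in sum_squares (q + Const c)" by (rule is_poly_inI)
  next
    have Const: "of_nat (2 * i + 2) * Const (r (2 * i + 1) * b i) = (Const (b i) :: ('n, 'a) mpoly)" for i
    proof -
      have "of_nat (2 * i + 2) * (r (2 * i + 1) * b i) = b i"
        using r[of "2 * i + 1"] by (simp add: mult.assoc[symmetric])
      moreover have "of_nat m = (Const (of_nat m) :: ('n, 'a) mpoly)" for m
        by (simp add: Const_def)
      moreover have "Const x * Const y = (Const (x * y) :: ('n, 'a) mpoly)" for x y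
        by (simp add: Const_def mult_single)
      ultimately show ?thesis by metis
    qed
    fix k :: 'n
    have "partial_deriv k (Const (r (2 * i + 1) * b i) * sum_squares ^ Suc i) =
        X k * (Const (b i) * sum_squares ^ i)" for i
    proof -
      have "partial_deriv k (Const (r (2 * i + 1) * b i) * sum_squares ^ Suc i) =
          (of_nat (2 * i + 2) * Const (r (2 * i + 1) * b i)) * sum_squares ^ i * X k"
        unfolding partial_deriv_mult partial_deriv_power partial_deriv_sum_squares
          partial_deriv_Const
        by (simp add: algebra_simps)
      also have "\<dots> = X k * (Const (b i) * sum_squares ^ i)"
        unfolding Const by (simp add: ac_simps)
      finally show ?thesis .
    qed
    then show "partial_deriv k q = X k * g"
      unfolding q_def g partial_deriv_sum sum_distrib_left by simp
  qed
qed

lemma is_poly_in_if_M_zero: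
  fixes p :: "('n::finite, 'a::comm_ring_1) mpoly"
  assumes "contains_rationals TYPE('a)" "CARD('n) \<ge> 2" "\<And>j k. j \<noteq> k \<Longrightarrow> M j k p = 0"
  shows "is_poly_in sum_squares p"
proof -
  \<comment> \<open>Induction on a strict degree bound, so that the base case is the zero
    polynomial.\<close>
  have "is_poly_in sum_squares p"
    if "\<And>m. Poly_Mapping.lookup p m \<noteq> 0 \<Longrightarrow> monom_degree m < d" "\<And>j k. j \<noteq> k \<Longrightarrow> M j k p = 0"
    for d and p :: "('n, 'a) mpoly"
    using that
  proof (induction d arbitrary: p)
    case 0
    then have "p = 0" by (intro poly_mapping_eqI) auto
    then show ?case by (intro is_poly_inI[where n = 0]) simp
  next
    case (Suc d)
    obtain g where g: "\<And>k. partial_deriv k p = X k * g"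
      using M_zero_partial_deriv[OF assms(2) Suc.prems(2)] by blast
    have "is_poly_in sum_squares g"
    proof (rule Suc.IH)
      fix m assume m: "Poly_Mapping.lookup g m \<noteq> 0"
      fix k :: 'n
      have "Poly_Mapping.lookup (partial_deriv k p) (m + Poly_Mapping.single k (Suc 0)) \<noteq> 0"
        using m by (simp add: g)
      \<comment> \<open>The coefficient of \<open>g\<close> at \<open>m\<close> stems from that of
        \<open>p\<close> two degrees higher.\<close>
      then have "Poly_Mapping.lookup p (m + Poly_Mapping.single k 1 + Poly_Mapping.single k 1) \<noteq> 0"
        unfolding lookup_partial_deriv by auto
      from Suc.prems(1)[OF this] show "monom_degree m < d" by simp
    next
      fix j k :: 'n assume "j \<noteq> k"
      \<comment> \<open>For distinct j, k the mixed derivatives of \<open>p\<close> are X_k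
        \<open>\<partial>\<^sub>j g\<close> and X_j \<open>\<partial>\<^sub>k g\<close>.\<close>
      then show "M j k g = 0"
        using partial_deriv_commute[of j k p]
        by (simp add: g M_def partial_deriv_mult partial_deriv_X)
    qed
    then obtain q where q: "\<And>c. is_poly_in sum_squares (q + Const c)"
      "\<And>k. partial_deriv k q = X k * g"
      using is_poly_in_antiderivative[OF assms(1)] by blast
    have "p - q = Const (Poly_Mapping.lookup (p - q) 0)"
      by (rule partial_deriv_all_zero[OF assms(1)]) (simp add: partial_deriv_diff g q(2))
    then show ?case using q(1) by (metis add.commute diff_add_cancel)
  qed
  moreover have "\<exists>d. \<forall>m. Poly_Mapping.lookup p m \<noteq> 0 \<longrightarrow> monom_degree m < d"
    using finite_nat_set_iff_bounded[of "monom_degree ` Poly_Mapping.keys p"]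
    by (metis finite_imageI finite_keys imageI in_keys_iff)
  ultimately show ?thesis using assms(3) by blast
qed

section \<open>Derivations annihilating the sum of squares\<close>

text \<open>Euler's formula, read off coefficient by coefficient so that no splitting into
  homogeneous parts is needed.\<close>

lemma sum_X_partial_deriv:
  "Poly_Mapping.lookup (\<Sum>j\<in>UNIV. X j * partial_deriv j p) m =
     of_nat (monom_degree m) * Poly_Mapping.lookup p m"
proof -
  have "Poly_Mapping.lookup (X j * partial_deriv j p) m =
      of_nat (Poly_Mapping.lookup m j) * Poly_Mapping.lookup p m" for j
    using diff_single_add_single[of m j]
    by (simp add: lookup_X_mult lookup_partial_deriv lookup_minus)
  then show ?thesis by (simp add: lookup_sum monom_degree_def sum_distrib_right)
qed

text \<open>Exactness of the Koszul complex of the variables in degree one. The contracting homotopy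
  is the exterior derivative, rescaled by degree.\<close>

lemma koszul_exact:
  fixes a :: "'n::finite \<Rightarrow> ('n, 'a::comm_ring_1) mpoly"
  assumes "contains_rationals TYPE('a)" "(\<Sum>k\<in>UNIV. X k * a k) = 0"
  obtains c where "\<And>j k. c j k = - c k j" "\<And>k. a k = (\<Sum>j\<in>UNIV. X j * c j k)"
proof -
  obtain r :: "nat \<Rightarrow> 'a" where r: "\<And>n. of_nat (Suc n) * r n = 1"
    using contains_rationals_inverse_Suc[OF assms(1)] by blast
  \<comment> \<open>\<open>T n\<close> divides the part of degree d by d + n + 1, so
    \<open>T 0\<close> inverts the Euler operator plus the identity.\<close>
  define T :: "nat \<Rightarrow> ('n, 'a) mpoly \<Rightarrow> ('n, 'a) mpoly"
    where "T n = Poly_Mapping.mapp (\<lambda>m x. r (monom_degree m + n) * x)" for n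
  have lookup_T: "Poly_Mapping.lookup (T n p) m = r (monom_degree m + n) * Poly_Mapping.lookup p m"
    for n p m by (simp add: T_def lookup_mapp when_def in_keys_iff)
  have T_sum: "T n (sum f A) = (\<Sum>i\<in>A. T n (f i))" for n f and A :: "'n set"
    by (intro poly_mapping_eqI) (simp add: lookup_T lookup_sum sum_distrib_left)
  \<comment> \<open>Multiplication by X_j raises the degree by one; hence the choice of
    \<open>T 1\<close> in \<open>c\<close>, which becomes \<open>T 0\<close> after that
    multiplication.\<close>
  have X_T: "X j * T (Suc n) p = T n (X j * p)" for j n p
  proof (rule poly_mapping_eqI)
    fix m
    have "monom_degree m = Suc (monom_degree (m - Poly_Mapping.single j 1))"
      if "Poly_Mapping.lookup m j \<noteq> 0"
      by (metis that diff_single_add_single monom_degree_add_single Suc_eq_plus1)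
    then show "Poly_Mapping.lookup (X j * T (Suc n) p) m = Poly_Mapping.lookup (T n (X j * p)) m"
      by (simp add: lookup_T lookup_X_mult)
  qed
  define c where "c j k = T 1 (partial_deriv j (a k) - partial_deriv k (a j))" for j k
  show thesis
  proof
    show "c j k = - c k j" for j k
      by (intro poly_mapping_eqI) (simp add: c_def lookup_T lookup_minus algebra_simps)
    fix k
    \<comment> \<open>Differentiating the relation between the \<open>a j\<close> by X_k expresses
      the unwanted half of the sum as \<open>- a k\<close>.\<close>
    have "partial_deriv k (X j * a j) = X j * partial_deriv k (a j) + (if k = j then a j else 0)" for j
      by (simp add: partial_deriv_mult partial_deriv_X)
    then have "partial_deriv k (\<Sum>j\<in>UNIV. X j * a j) =
        (\<Sum>j\<in>UNIV. X j * partial_deriv k (a j)) + a k"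
      by (simp only: partial_deriv_sum sum.distrib) simp
    then have "(\<Sum>j\<in>UNIV. X j * partial_deriv k (a j)) = - a k"
      by (simp add: assms(2) eq_neg_iff_add_eq_0)
    then have "(\<Sum>j\<in>UNIV. X j * (partial_deriv j (a k) - partial_deriv k (a j))) =
        (\<Sum>j\<in>UNIV. X j * partial_deriv j (a k)) + a k"
      by (simp add: right_diff_distrib sum_subtractf)
    then have "(\<Sum>j\<in>UNIV. X j * c j k) = T 0 ((\<Sum>j\<in>UNIV. X j * partial_deriv j (a k)) + a k)"
      by (simp add: c_def X_T flip: T_sum)
    also have "\<dots> = a k"
    proof (rule poly_mapping_eqI)
      fix m
      show "Poly_Mapping.lookup (T 0 ((\<Sum>j\<in>UNIV. X j * partial_deriv j (a k)) + a k)) m =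
          Poly_Mapping.lookup (a k) m"
        using r[of "monom_degree m"]
        unfolding lookup_T lookup_add sum_X_partial_deriv add_0_right
        by (metis (no_types, lifting) distrib_right mult.commute mult.left_commute mult_1 of_nat_Suc add.commute)
    qed
    finally show "a k = (\<Sum>j\<in>UNIV. X j * c j k)" by simp
  qed
qed

lemma derivation_sum_squares_zero:
  fixes L :: "('n::finite, 'a::comm_ring_1) mpoly \<Rightarrow> ('n, 'a) mpoly"
  assumes "contains_rationals TYPE('a)" "derivation L" "L sum_squares = 0"
  shows "\<exists>c. L = (\<lambda>p. \<Sum>(j, k)\<in>{(j, k). j \<noteq> k}. c j k * M j k p)"
proof -
  obtain r :: "nat \<Rightarrow> 'a" where "\<And>n. of_nat (Suc n) * r n = 1"
    using contains_rationals_inverse_Suc[OF assms(1)] by blast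
  from this[of 1] have "r 1 + r 1 = 1"
    by (simp only: of_nat_Suc of_nat_1 distrib_right mult_1_left)
  \<comment> \<open>\<open>r 1\<close> is one half. This additive form cancels the factor 2 in L(s)
    and later the double counting of ordered pairs.\<close>
  then have half: "Const (r 1) * p + Const (r 1) * p = p" for p :: "('n, 'a) mpoly"
    unfolding Const_def by (metis distrib_right mult_1 single_add single_one)
  have "0 = (\<Sum>k\<in>UNIV. L (X k) * (2 * X k))"
    using assms(3) derivation_eq_sum_partial_deriv[OF assms(2)]
    by (metis (no_types, lifting) partial_deriv_sum_squares sum.cong)
  also have "\<dots> = (\<Sum>k\<in>UNIV. X k * L (X k)) + (\<Sum>k\<in>UNIV. X k * L (X k))"
    by (simp only: mult_2 distrib_left sum.distrib mult.commute[of "L _"])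
  finally have double: "(\<Sum>k\<in>UNIV. X k * L (X k)) + (\<Sum>k\<in>UNIV. X k * L (X k)) = 0" by simp
  have zero: "(\<Sum>k\<in>UNIV. X k * L (X k)) = 0"
    using half[of "\<Sum>k\<in>UNIV. X k * L (X k)"]
    unfolding distrib_left[symmetric] double by simp
  obtain c where c: "\<And>j k. c j k = - c k j" "\<And>k. L (X k) = (\<Sum>j\<in>UNIV. X j * c j k)"
    using koszul_exact[OF assms(1) zero] by blast
  have "L p = (\<Sum>(j, k)\<in>{(j, k). j \<noteq> k}. (Const (r 1) * c j k) * M j k p)" for p
  proof -
    define S where "S = (\<Sum>k\<in>UNIV. \<Sum>j\<in>UNIV. c j k * (X j * partial_deriv k p))"
    have L: "L p = S"
      using derivation_eq_sum_partial_deriv[OF assms(2), THEN fun_cong, of p]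
      by (simp add: c(2) S_def sum_distrib_left sum_distrib_right ac_simps)
    \<comment> \<open>By antisymmetry, exchanging the indices shows that the second terms of the
      \<open>M j k\<close> sum to \<open>- S\<close>, so the full sum is twice
      \<open>S\<close>.\<close>
    have "(\<Sum>k\<in>UNIV. \<Sum>j\<in>UNIV. c j k * (X k * partial_deriv j p)) =
        (\<Sum>k\<in>UNIV. \<Sum>j\<in>UNIV. c k j * (X j * partial_deriv k p))"
      by (rule sum.swap)
    also have "\<dots> = (\<Sum>k\<in>UNIV. \<Sum>j\<in>UNIV. - (c j k * (X j * partial_deriv k p)))"
      using c(1) by (intro sum.cong refl) (metis mult_minus_left)
    finally have S': "(\<Sum>k\<in>UNIV. \<Sum>j\<in>UNIV. c j k * (X k * partial_deriv j p)) = - S"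
      by (simp add: S_def sum_negf)
    \<comment> \<open>The diagonal may be added because \<open>M j j\<close> is zero.\<close>
    have "(\<Sum>(j, k)\<in>{(j, k). j \<noteq> k}. (Const (r 1) * c j k) * M j k p) =
        (\<Sum>(j, k)\<in>UNIV. (Const (r 1) * c j k) * M j k p)"
      by (rule sum.mono_neutral_left) (auto simp: M_def)
    also have "\<dots> = (\<Sum>j\<in>UNIV. \<Sum>k\<in>UNIV. (Const (r 1) * c j k) * M j k p)"
      by (simp add: sum.cartesian_product UNIV_Times_UNIV)
    also have "\<dots> = (\<Sum>k\<in>UNIV. \<Sum>j\<in>UNIV. (Const (r 1) * c j k) * M j k p)"
      by (rule sum.swap)
    also have "\<dots> = Const (r 1) * (S - - S)"
      unfolding S'[symmetric] unfolding S_def M_def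
      by (simp add: right_diff_distrib sum_subtractf sum_distrib_left ac_simps)
    also have "\<dots> = L p"
      unfolding L diff_minus_eq_add distrib_left by (rule half)
    finally show ?thesis by simp
  qed
  then show ?thesis by (intro exI[of _ "\<lambda>j k. Const (r 1) * c j k"] ext)
qed

theorem proposition1p1:
  assumes "contains_rationals TYPE('a::comm_ring_1)"
    and "CARD('n) \<ge> 2"
  shows "(\<forall>p :: ('n::finite, 'a::comm_ring_1) mpoly. (\<forall>j k. j \<noteq> k \<longrightarrow> M j k p = 0) \<longleftrightarrow> is_poly_in sum_squares p) \<and>
    (\<forall>L :: ('n, 'a) mpoly \<Rightarrow> ('n, 'a) mpoly. derivation L \<longrightarrow>
       (L sum_squares = 0 \<longleftrightarrow>
        (\<exists>c :: 'n \<Rightarrow> 'n \<Rightarrow> ('n, 'a) mpoly.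
           L = (\<lambda>p. \<Sum>(j, k)\<in>{(j, k). j \<noteq> k}. c j k * M j k p))))"
proof (intro conjI allI impI iffI)
  fix p :: "('n, 'a) mpoly" assume "\<forall>j k. j \<noteq> k \<longrightarrow> M j k p = 0"
  then show "is_poly_in sum_squares p"
    using is_poly_in_if_M_zero[OF assms] by blast
next
  fix L :: "('n, 'a) mpoly \<Rightarrow> ('n, 'a) mpoly"
  assume "derivation L" "L sum_squares = 0"
  then show "\<exists>c. L = (\<lambda>p. \<Sum>(j, k)\<in>{(j, k). j \<noteq> k}. c j k * M j k p)"
    using derivation_sum_squares_zero[OF assms(1)] by blast
next
  fix L :: "('n, 'a) mpoly \<Rightarrow> ('n, 'a) mpoly"
  assume "\<exists>c. L = (\<lambda>p. \<Sum>(j, k)\<in>{(j, k). j \<noteq> k}. c j k * M j k p)"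
  moreover have "M j k (sum_squares :: ('n, 'a) mpoly) = 0" for j k
    by (simp add: M_def partial_deriv_sum_squares ac_simps)
  ultimately show "L sum_squares = 0" by auto
qed (rule M_poly_sum_squares)

end
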